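(* Let $m,n$ be positive integers and let $\mathcal{S}\in F(m,n,4)$ be an f-diagonal tensor. Then $\mathcal{S}\in S(m,n,4)$ if and only if all of the following hold: (a) $\mathcal{S}(i,i,2)=\mathcal{S}(i,i,4)$ for $i=1,2,\dots,\min\{m,n\}$; (b) $\mathcal{S}(i,i,1)+\mathcal{S}(i,i,3)\ge\max\{2|\mathcal{S}(i,i,2)|,\ 2\mathcal{S}(i,i,3)\}$ for $i=1,2,\dots,\min\{m,n\}$; (c) $[\mathcal{S}(i,i,1)-\mathcal{S}(i+1,i+1,1)]+[\mathcal{S}(i,i,3)-\mathcal{S}(i+1,i+1,3)]\ge\max\{2|\mathcal{S}(i,i,2)-\mathcal{S}(i+1,i+1,2)|,\ 2[\mathcal{S}(i,i,3)-\mathcal{S}(i+1,i+1,3)]\}$ for $i=1,2,\dots,\min\{m,n\}-1$.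
   Context: Let $T(m,n,p)$ be the real linear space of $m\times n\times p$ real tensors; $\mathcal{A}(i,j,k)$ denotes the entries of $\mathcal{A}\in T(m,n,p)$ and $A^{(k)}=\mathcal{A}(:,:,k)\in\mathbb{R}^{m\times n}$ its frontal slices, $k=1,\dots,p$. A tensor is f-diagonal if all its frontal slices are (rectangular) diagonal matrices; $F(m,n,p)$ is the set of f-diagonal tensors in $T(m,n,p)$. Kilmer-Martin mapping $G:T(m,n,p)\to F(m,n,p)$. Let $\omega=e^{2\pi\sqrt{-1}/p}$. For $\mathcal{A}\in T(m,n,p)$ and $k=1,\dots,p$ put $\Delta^{(k)}(\mathcal{A})=\sum_{l=1}^p\omega^{(l-1)(k-1)}A^{(l)}\in\mathbb{C}^{m\times n}$, and let $\mathcal{D}(i,i,k)$, $i=1,\dots,\min\{m,n\}$, be the singular values of $\Delta^{(k)}(\mathcal{A})$ in nonincreasing order (counted with multiplicity). Then $\mathcal{S}=G(\mathcal{A})$ is the f-diagonal tensor with $\mathcal{S}(i,i,k)=\frac1p\sum_{l=1}^p\bar\omega^{(k-1)(l-1)}\mathcal{D}(i,i,l)$ for $i=1,\dots,\min\{m,n\}$, $k=1,\dots,p$ (these numbers are real). A tensor $\mathcal{S}\in F(m,n,p)$ is called s-diagonal if there is some $\mathcal{A}\in T(m,n,p)$ with $G(\mathcal{A})=\mathcal{S}$; $S(m,n,p)$ denotes the set of all s-diagonal tensors in $F(m,n,p)$. Here $p=4$. *)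

theory Defs
  imports
    "HOL-Library.Multiset"
    "HOL-Computational_Algebra.Polynomial"
    "Jordan_Normal_Form.Schur_Decomposition"
begin

(* An m x n x p real tensor is a function of the three 1-based indices that vanishes outside the
   index range, so that equality of tensors is equality of functions. *)
type_synonym tensor = "nat \<Rightarrow> nat \<Rightarrow> nat \<Rightarrow> real"

definition tensors :: "nat \<Rightarrow> nat \<Rightarrow> nat \<Rightarrow> tensor set" where
  "tensors m n p =
     {A. \<forall>i j k. \<not> (i \<in> {1..m} \<and> j \<in> {1..n} \<and> k \<in> {1..p}) \<longrightarrow> A i j k = 0}"

(* Matrices of Jordan_Normal_Form are indexed from 0, hence the shifts. *)
definition frontal_slice :: "nat \<Rightarrow> nat \<Rightarrow> tensor \<Rightarrow> nat \<Rightarrow> real mat" where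
  "frontal_slice m n A k = mat m n (\<lambda>(i, j). A (Suc i) (Suc j) k)"

definition f_diagonal_tensors :: "nat \<Rightarrow> nat \<Rightarrow> nat \<Rightarrow> tensor set" where
  "f_diagonal_tensors m n p =
     {S \<in> tensors m n p. \<forall>k\<in>{1..p}. diagonal_mat (frontal_slice m n S k)}"

(* Nonincreasing list, with multiplicity, of the min r c singular values of an r x c matrix M: the
   square roots of the c eigenvalues of the positive semidefinite matrix M^H M (so Re only changes
   the type). If r < c, the entries dropped by take are c - r zeros. *)
definition singular_values :: "complex mat \<Rightarrow> real list" where
  "singular_values M =
     take (min (dim_row M) (dim_col M))
       (rev (sorted_list_of_multiset
          (image_mset (\<lambda>z. sqrt (Re z)) (proots (char_poly (mat_adjoint M * M))))))"

definition omega :: "nat \<Rightarrow> complex" where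
  "omega p = exp (2 * of_real pi * \<i> / of_nat p)"

definition Delta :: "nat \<Rightarrow> nat \<Rightarrow> nat \<Rightarrow> tensor \<Rightarrow> nat \<Rightarrow> complex mat" where
  "Delta m n p A k =
     mat m n (\<lambda>ij. \<Sum>l=1..p. omega p ^ ((l - 1) * (k - 1)) * of_real (frontal_slice m n A l $$ ij))"

definition D_diag :: "nat \<Rightarrow> nat \<Rightarrow> nat \<Rightarrow> tensor \<Rightarrow> nat \<Rightarrow> nat \<Rightarrow> real" where
  "D_diag m n p A i k = singular_values (Delta m n p A k) ! (i - 1)"

(* The Kilmer-Martin mapping; the sum is real by Kilmer_Martin_real below, so Re only changes the
   type. *)
definition Kilmer_Martin :: "nat \<Rightarrow> nat \<Rightarrow> nat \<Rightarrow> tensor \<Rightarrow> tensor" where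
  "Kilmer_Martin m n p A = (\<lambda>i j k.
     if i = j \<and> i \<in> {1..min m n} \<and> k \<in> {1..p}
     then Re (1 / of_nat p *
            (\<Sum>l=1..p. cnj (omega p) ^ ((k - 1) * (l - 1)) * of_real (D_diag m n p A i l)))
     else 0)"

definition s_diagonal_tensors :: "nat \<Rightarrow> nat \<Rightarrow> nat \<Rightarrow> tensor set" where
  "s_diagonal_tensors m n p =
     {S \<in> f_diagonal_tensors m n p. \<exists>A\<in>tensors m n p. Kilmer_Martin m n p A = S}"

lemma mat_adjoint_dim: "dim_row (mat_adjoint M) = dim_col M" "dim_col (mat_adjoint M) = dim_row M"
  unfolding mat_adjoint_def by auto

lemma mat_adjoint_index:
  assumes "i < dim_col M" "j < dim_row M"
  shows "mat_adjoint M $$ (i, j) = conjugate (M $$ (j, i))"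
  using assms unfolding mat_adjoint_def by (simp add: mat_of_rows_index)

lemma singular_values_cnj: "singular_values (map_mat cnj M) = singular_values M"
proof -
  have "mat_adjoint (map_mat cnj M) * map_mat cnj M = transpose_mat (mat_adjoint M * M)"
    (is "?L = ?R")
  proof (rule eq_matI)
    fix i j assume "i < dim_row ?R" "j < dim_col ?R"
    then have ij: "i < dim_col M" "j < dim_col M" by (simp_all add: mat_adjoint_dim)
    have "?L $$ (i, j) = (\<Sum>k<dim_row M. M $$ (k, i) * cnj (M $$ (k, j)))"
      using ij by (simp add: mat_adjoint_dim scalar_prod_def mat_adjoint_index lessThan_atLeast0)
    moreover have "?R $$ (i, j) = (\<Sum>k<dim_row M. cnj (M $$ (k, j)) * M $$ (k, i))"
      using ij by (simp add: mat_adjoint_dim scalar_prod_def mat_adjoint_index lessThan_atLeast0)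
    ultimately show "?L $$ (i, j) = ?R $$ (i, j)" by (simp only: mult.commute)
  qed (simp_all add: mat_adjoint_dim)
  moreover have "mat_adjoint M * M \<in> carrier_mat (dim_col M) (dim_col M)"
    by (rule carrier_matI) (simp_all add: mat_adjoint_dim)
  ultimately show ?thesis
    by (simp add: singular_values_def)
qed

lemma omega_power_p: "0 < p \<Longrightarrow> omega p ^ p = 1"
  by (simp add: omega_def flip: exp_of_nat_mult)

lemma cnj_omega: "cnj (omega p) * omega p = 1"
proof -
  have "omega p = cis (2 * pi / p)"
    by (simp add: omega_def cis_conv_exp mult_ac)
  then show ?thesis by (simp add: cis_cnj cis_mult)
qed

lemma cnj_omega_power:
  assumes "0 < p" "a + b = p"
  shows "cnj (omega p) ^ (c * a) = omega p ^ (c * b)"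
proof -
  have "omega p ^ (c * a) * omega p ^ (c * b) = (omega p ^ p) ^ c"
    using assms(2) by (metis add_mult_distrib2 mult.commute power_add power_mult)
  then have *: "omega p ^ (c * a) * omega p ^ (c * b) = 1"
    using omega_power_p[OF assms(1)] by simp
  have "cnj (omega p) ^ (c * a) * omega p ^ (c * a) = 1"
    by (metis cnj_omega power_mult_distrib power_one)
  then have "cnj (omega p) ^ (c * a) * (omega p ^ (c * a) * omega p ^ (c * b)) = omega p ^ (c * b)"
    by (simp flip: mult.assoc)
  then show ?thesis using * by simp
qed

lemma Delta_cnj:
  assumes "0 < p" "a + b = p"
  shows "map_mat cnj (Delta m n p A (Suc a)) = Delta m n p A (Suc b)"
  by (rule eq_matI) (auto simp: Delta_def cnj_omega_power[OF assms])

lemma D_diag_cnj: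
  assumes "0 < p" "a + b = p"
  shows "D_diag m n p A i (Suc a) = D_diag m n p A i (Suc b)"
  by (metis D_diag_def Delta_cnj[OF assms] singular_values_cnj)

lemma Kilmer_Martin_real:
  assumes "0 < p"
  shows "1 / of_nat p *
    (\<Sum>l=1..p. cnj (omega p) ^ ((k - 1) * (l - 1)) * of_real (D_diag m n p A i l)) \<in> \<real>"
proof -
  define f where "f = (\<lambda>l. cnj (omega p) ^ ((k - 1) * l) * of_real (D_diag m n p A i (Suc l)))"
  have f_cnj: "cnj (f a) = f b" if "a + b = p" for a b
    using cnj_omega_power[OF assms, of b a "k - 1"] D_diag_cnj[OF assms that, of m n A i] that
    by (simp add: f_def add.commute)
  have f_p: "f p = f 0"
    using cnj_omega_power[OF assms, of p 0 "k - 1"] D_diag_cnj[OF assms, of p 0 m n A i]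
    by (simp add: f_def)
  have "cnj (\<Sum>l<p. f l) = (\<Sum>l<p. f (p - l))"
    by (auto simp: f_cnj intro!: sum.cong)
  also have "\<dots> = (\<Sum>l<p. f (Suc l))"
    by (rule sum.reindex_bij_witness[where i = "\<lambda>l. p - Suc l" and j = "\<lambda>l. p - Suc l"])
      (auto simp: Suc_diff_Suc)
  also have "\<dots> = (\<Sum>l<p. f l)"
    using sum.lessThan_Suc_shift[of f p] f_p by simp
  finally have "(\<Sum>l<p. f l) \<in> \<real>"
    by (simp add: Reals_cnj_iff)
  moreover have "(\<Sum>l=1..p. cnj (omega p) ^ ((k - 1) * (l - 1)) * of_real (D_diag m n p A i l))
      = (\<Sum>l<p. f l)"
    unfolding f_def
    by (rule sum.reindex_bij_witness[where i = Suc and j = "\<lambda>l. l - 1"]) auto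
  ultimately show ?thesis by (simp add: Reals_mult)
qed

end

theory Submission
  imports
    Defs
    "HOL-Computational_Algebra.Fundamental_Theorem_Algebra"
begin

text \<open>
  Write \<open>S\<^sub>k\<close> for \<open>S(i,i,k)\<close> and \<open>d\<^sub>k i\<close> for the \<open>i\<close>-th singular value of \<open>\<Delta>\<^sup>(\<^sup>k\<^sup>)\<close>. The Kilmer-Martin mapping is a diagonalwise
  inverse Fourier transform, and for \<open>p = 4\<close> the transform of a diagonal with \<open>S(i,i,2) = S(i,i,4)\<close>
  is real: \<open>d\<^sub>1 = S\<^sub>1 + 2 S\<^sub>2 + S\<^sub>3\<close>, \<open>d\<^sub>2 = d\<^sub>4 = S\<^sub>1 - S\<^sub>3\<close>, \<open>d\<^sub>3 = S\<^sub>1 - 2 S\<^sub>2 + S\<^sub>3\<close>. So (b) says that all \<open>d\<^sub>k i\<close> are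
  nonnegative and (c) that they are nonincreasing in \<open>i\<close>. Conversely, if (a), (b) and (c) hold, then
  each \<open>\<Delta>\<^sup>(\<^sup>k\<^sup>)\<close> of \<open>S\<close> itself is a diagonal matrix that lists its own singular values in
  nonincreasing order, so \<open>S\<close> is a fixed point of the mapping.
\<close>

section \<open>Singular values of a complex matrix\<close>

lemma cscalar_prod_mat_adjoint:
  fixes M :: "complex mat"
  assumes "v \<in> carrier_vec (dim_col M)" "w \<in> carrier_vec (dim_row M)"
  shows "(mat_adjoint M *\<^sub>v w) \<bullet>c v = w \<bullet>c (M *\<^sub>v v)"
proof -
  have "(mat_adjoint M *\<^sub>v w) \<bullet>c v =
      (\<Sum>i<dim_col M. \<Sum>j<dim_row M. cnj (M $$ (j, i)) * w $ j * cnj (v $ i))"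
    using assms
    by (simp add: scalar_prod_def mat_adjoint_dim mat_adjoint_index lessThan_atLeast0
        sum_distrib_right)
  also have "\<dots> = (\<Sum>j<dim_row M. \<Sum>i<dim_col M. cnj (M $$ (j, i)) * w $ j * cnj (v $ i))"
    by (rule sum.swap)
  also have "\<dots> = w \<bullet>c (M *\<^sub>v v)"
    using assms
    by (simp add: scalar_prod_def lessThan_atLeast0 sum_distrib_left mult_ac)
  finally show ?thesis .
qed

text \<open>An eigenvector \<open>v\<close> for \<open>z\<close> satisfies
  \<open>z * |v|^2 = |M v|^2\<close>, with \<open>|v|^2\<close> real and positive.\<close>

lemma eigenvalue_adjoint_mult_self_nonneg:
  fixes M :: "complex mat"
  assumes "eigenvalue (mat_adjoint M * M) z"
  shows "0 \<le> Re z"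
proof -
  have adj: "mat_adjoint M \<in> carrier_mat (dim_col M) (dim_row M)"
    by (rule carrier_matI) (simp_all add: mat_adjoint_dim)
  obtain v where v: "v \<in> carrier_vec (dim_col M)" "v \<noteq> 0\<^sub>v (dim_col M)"
    and eq: "(mat_adjoint M * M) *\<^sub>v v = z \<cdot>\<^sub>v v"
    using assms unfolding eigenvalue_def eigenvector_def by (auto simp: mat_adjoint_dim)
  have Mv: "M *\<^sub>v v \<in> carrier_vec (dim_row M)"
    by (rule carrier_vecI) simp
  have "z * (v \<bullet>c v) = (z \<cdot>\<^sub>v v) \<bullet>c v"
    using v by simp
  also have "\<dots> = (mat_adjoint M *\<^sub>v (M *\<^sub>v v)) \<bullet>c v"
    using assoc_mult_mat_vec[OF adj carrier_matI[OF refl refl] v(1)] eq by simp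
  also have "\<dots> = (M *\<^sub>v v) \<bullet>c (M *\<^sub>v v)"
    by (rule cscalar_prod_mat_adjoint[OF v(1) Mv])
  finally have z: "z * (v \<bullet>c v) = (M *\<^sub>v v) \<bullet>c (M *\<^sub>v v)" .
  have "0 < v \<bullet>c v" "0 \<le> (M *\<^sub>v v) \<bullet>c (M *\<^sub>v v)"
    using conjugate_square_greater_0_vec[OF v(1)] v(2) by auto
  then have "0 < Re (v \<bullet>c v)" "Im (v \<bullet>c v) = 0" "0 \<le> Re (z * (v \<bullet>c v))"
    unfolding z by (auto simp: less_complex_def less_eq_complex_def)
  then show ?thesis
    by (simp add: zero_le_mult_iff)
qed

text \<open>On the reals \<open>sqrt\<close> is odd, so the sign of \<open>sqrt (Re z)\<close> is
  that of \<open>Re z\<close> and has to come from the eigenvalue \<open>z\<close>.\<close>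

lemma singular_values_nonneg:
  assumes "x \<in> set (singular_values M)"
  shows "0 \<le> x"
proof -
  let ?P = "char_poly (mat_adjoint M * M)"
  have car: "mat_adjoint M * M \<in> carrier_mat (dim_col M) (dim_col M)"
    by (rule carrier_matI) (simp_all add: mat_adjoint_dim)
  have "?P \<noteq> 0"
    using degree_monic_char_poly[OF car] by auto
  moreover obtain z where "z \<in># proots ?P" "x = sqrt (Re z)"
    using assms unfolding singular_values_def by (auto dest!: in_set_takeD)
  ultimately show ?thesis
    using eigenvalue_adjoint_mult_self_nonneg eigenvalue_root_char_poly[OF car] by auto
qed

text \<open>By the fundamental theorem of algebra the characteristic polynomial has
  \<open>dim_col M\<close> roots with multiplicity, so \<open>take\<close> never runs short.\<close>

lemma length_singular_values: "length (singular_values M) = min (dim_row M) (dim_col M)"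
proof -
  have car: "mat_adjoint M * M \<in> carrier_mat (dim_col M) (dim_col M)"
    by (rule carrier_matI) (simp_all add: mat_adjoint_dim)
  have "length (sorted_list_of_multiset X) = size X" for X :: "real multiset"
    by (metis mset_sorted_list_of_multiset size_mset)
  then show ?thesis
    using degree_monic_char_poly[OF car]
    by (simp add: singular_values_def size_proots_complex)
qed

lemma sorted_singular_values: "sorted_wrt (\<ge>) (singular_values M)"
  unfolding singular_values_def by (intro sorted_wrt_take) (simp add: sorted_wrt_rev)

text \<open>Reads the eigenvalues with multiplicity off the factored characteristic polynomial of a
  triangular matrix.\<close>

lemma proots_prod_linear_factors:
  "proots (\<Prod>a\<leftarrow>xs. [:- a, 1:]) = mset xs" for xs :: "'a::idom list"
proof (induction xs)
  case (Cons a xs)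
  have "(\<Prod>a\<leftarrow>xs. [:- a, 1:]) \<noteq> 0"
    by (auto simp: prod_list_zero_iff)
  then show ?case
    using Cons.IH by (simp add: proots_mult del: mult_pCons_left)
qed simp

text \<open>If \<open>r < c\<close>, then \<open>M^H M\<close> has \<open>c - r\<close> further
  eigenvalues 0. As \<open>d\<close> is nonnegative, they may stand last in the nonincreasing list,
  where \<open>take\<close> drops them.\<close>

lemma singular_values_diagonal_mat:
  fixes d :: "nat \<Rightarrow> real"
  assumes M: "M \<in> carrier_mat r c" "diagonal_mat M"
    and diag: "\<And>i. i < min r c \<Longrightarrow> M $$ (i, i) = of_real (d i)"
    and nonneg: "\<And>i. i < min r c \<Longrightarrow> 0 \<le> d i"
    and antimono: "\<And>i. Suc i < min r c \<Longrightarrow> d (Suc i) \<le> d i"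
  shows "singular_values M = map d [0..<min r c]"
proof -
  \<comment> \<open>The \<open>c\<close> eigenvalues of \<open>M\<^sup>H M\<close> are the squares of \<open>e 0, \<dots>, e (c - 1)\<close>.\<close>
  define e where "e i = (if i < r then d i else 0)" for i
  let ?N = "mat_adjoint M * M"
  have N: "?N \<in> carrier_mat c c"
    using M(1) by (intro carrier_matI) (simp_all add: mat_adjoint_dim)
  have N_index: "?N $$ (i, j) = (if i = j then of_real ((e i)\<^sup>2) else 0)"
    if ij: "i < c" "j < c" for i j
  proof -
    have "?N $$ (i, j) = (\<Sum>k<r. cnj (M $$ (k, i)) * M $$ (k, j))"
      using ij M(1)
      by (simp add: mat_adjoint_dim scalar_prod_def mat_adjoint_index lessThan_atLeast0)
    \<comment> \<open>Column \<open>i\<close> of \<open>M\<close> can be nonzero only in row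
      \<open>i\<close>, and that row exists only for \<open>i < r\<close>.\<close>
    also have "\<dots> = (\<Sum>k<r. if k = i then (if i = j then of_real ((d i)\<^sup>2) else 0) else 0)"
      using ij M diag by (intro sum.cong) (auto simp: diagonal_mat_def power2_eq_square)
    also have "\<dots> = (if i = j then of_real ((e i)\<^sup>2) else 0)"
      by (simp add: e_def)
    finally show ?thesis .
  qed
  have "upper_triangular ?N"
    using N N_index by (auto simp: upper_triangular_def)
  moreover have "diag_mat ?N = map (\<lambda>i. of_real ((e i)\<^sup>2)) [0..<c]"
    using N N_index by (auto simp: diag_mat_def simp del: index_mult_mat)
  ultimately have "proots (char_poly ?N) = mset (map (\<lambda>i. of_real ((e i)\<^sup>2)) [0..<c])"
    using char_poly_upper_triangular[OF N] proots_prod_linear_factors by metis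
  moreover have e_nonneg: "0 \<le> e i" if "i < c" for i
    using that nonneg by (simp add: e_def)
  ultimately have "image_mset (\<lambda>z. sqrt (Re z)) (proots (char_poly ?N)) = mset (map e [0..<c])"
    by (auto intro!: image_mset_cong simp: multiset.map_comp o_def)
  moreover have "sorted_wrt (\<ge>) (map e [0..<c])"
  proof -
    have "e (Suc i) \<le> e i" if "Suc i < c" for i
      using that nonneg antimono by (auto simp: e_def)
    then show ?thesis
      by (subst sorted_wrt_iff_nth_Suc_transp) (auto intro: transpI)
  qed
  then have "sort (map e [0..<c]) = rev (map e [0..<c])"
    by (intro properties_for_sort) (simp_all add: sorted_wrt_rev)
  ultimately have "singular_values M = take (min r c) (map e [0..<c])"
    using M(1) sorted_list_of_multiset_mset[of "map e [0..<c]"]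
    by (simp add: singular_values_def del: sorted_list_of_multiset_mset)
  then show ?thesis
    by (simp add: take_map e_def)
qed

section \<open>Diagonals of \<open>Delta\<close> and of f-diagonal tensors\<close>

lemma Delta_carrier: "Delta m n p A k \<in> carrier_mat m n"
  by (simp add: Delta_def)

lemma D_diag_nonneg:
  assumes "i \<in> {1..min m n}"
  shows "0 \<le> D_diag m n p A i k"
  unfolding D_diag_def using assms
  by (intro singular_values_nonneg[OF nth_mem]) (use Delta_carrier[of m n p A k] in \<open>auto simp: length_singular_values\<close>)

lemma D_diag_antimono:
  assumes "i \<in> {1..min m n - 1}"
  shows "D_diag m n p A (i + 1) k \<le> D_diag m n p A i k"
proof -
  have "i - 1 < i" "i < min m n"
    using assms by auto
  then show ?thesis
    using sorted_wrt_nth_less[OF sorted_singular_values, of "i - 1" i "Delta m n p A k"]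
      Delta_carrier[of m n p A k]
    by (simp add: D_diag_def length_singular_values)
qed

lemma D_diag_diagonal:
  fixes d :: "nat \<Rightarrow> real"
  assumes "diagonal_mat (Delta m n p A k)"
    and "\<And>i. i \<in> {1..min m n} \<Longrightarrow> Delta m n p A k $$ (i - 1, i - 1) = of_real (d i)"
    and "\<And>i. i \<in> {1..min m n} \<Longrightarrow> 0 \<le> d i"
    and "\<And>i. i \<in> {1..min m n - 1} \<Longrightarrow> d (i + 1) \<le> d i"
    and "i \<in> {1..min m n}"
  shows "D_diag m n p A i k = d i"
proof -
  have "singular_values (Delta m n p A k) = map (\<lambda>i. d (Suc i)) [0..<min m n]"
  proof (rule singular_values_diagonal_mat[OF Delta_carrier])
    show "Delta m n p A k $$ (i, i) = of_real (d (Suc i))" if "i < min m n" for i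
      using assms(2)[of "Suc i"] that by simp
  qed (use assms in auto)
  then show ?thesis
    using assms(5) by (cases i) (simp_all add: D_diag_def Suc_le_eq del: upt_Suc)
qed

lemma f_diagonal_tensors_off_diagonal:
  assumes "S \<in> f_diagonal_tensors m n p" "i \<noteq> j"
  shows "S i j k = 0"
proof (cases "i \<in> {1..m} \<and> j \<in> {1..n} \<and> k \<in> {1..p}")
  case True
  then have "diagonal_mat (frontal_slice m n S k)"
    using assms(1) by (auto simp: f_diagonal_tensors_def)
  then have "frontal_slice m n S k $$ (i - 1, j - 1) = 0"
    using True assms(2) by (cases i; cases j) (simp_all add: diagonal_mat_def frontal_slice_def Suc_le_eq)
  then show ?thesis
    using True by (cases i; cases j) (simp_all add: frontal_slice_def Suc_le_eq)
next
  case False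
  then show ?thesis
    using assms(1) unfolding f_diagonal_tensors_def tensors_def by blast
qed

section \<open>The transform of length four\<close>

lemma omega_4: "omega 4 = \<i>"
proof -
  have "omega 4 = cis (pi / 2)"
    by (simp add: omega_def cis_conv_exp mult_ac)
  then show ?thesis by simp
qed

lemma sum_1_4: "sum f {Suc 0..4} = f 1 + f 2 + f 3 + f 4" for f :: "nat \<Rightarrow> 'a::comm_monoid_add"
  by (simp add: numeral_eq_Suc add.assoc)

text \<open>The exponents \<open>(k - 1) * (l - 1)\<close> with \<open>k\<close> and
  \<open>l\<close> in \<open>{1..4}\<close> are 0, 1, 2, 3, 4, 6 and 9.\<close>

lemma i_powers: "\<i> ^ 3 = - \<i>" "\<i> ^ 4 = 1" "\<i> ^ 6 = - 1" "\<i> ^ 9 = \<i>"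
  by (simp_all add: numeral_eq_Suc)

lemma Kilmer_Martin_4:
  fixes m n :: nat and A :: tensor
  assumes "i \<in> {1..min m n}"
  defines "d \<equiv> D_diag m n 4 A i"
  shows "Kilmer_Martin m n 4 A i i 1 = (d 1 + 2 * d 2 + d 3) / 4"
    and "Kilmer_Martin m n 4 A i i 2 = (d 1 - d 3) / 4"
    and "Kilmer_Martin m n 4 A i i 3 = (d 1 - 2 * d 2 + d 3) / 4"
    and "Kilmer_Martin m n 4 A i i 4 = (d 1 - d 3) / 4"
proof -
  \<comment> \<open>The matrices \<open>Delta\<close> at 2 and 4 are complex conjugates, because
    \<open>A\<close> is real.\<close>
  have "d 4 = d 2"
    using D_diag_cnj[of 4 3 1 m n A i] by (simp add: d_def numeral_eq_Suc)
  then show "Kilmer_Martin m n 4 A i i 1 = (d 1 + 2 * d 2 + d 3) / 4"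
    and "Kilmer_Martin m n 4 A i i 2 = (d 1 - d 3) / 4"
    and "Kilmer_Martin m n 4 A i i 3 = (d 1 - 2 * d 2 + d 3) / 4"
    and "Kilmer_Martin m n 4 A i i 4 = (d 1 - d 3) / 4"
    using assms(1)
    by (simp_all add: Kilmer_Martin_def omega_4 sum_1_4 i_powers flip: d_def)
qed

theorem theorem7p3:
  fixes m n :: nat and S :: tensor
  assumes "m > 0" and "n > 0"
    and "S \<in> f_diagonal_tensors m n 4"
  shows "S \<in> s_diagonal_tensors m n 4 \<longleftrightarrow>
    (\<forall>i\<in>{1..min m n}. S i i 2 = S i i 4) \<and>
    (\<forall>i\<in>{1..min m n}. S i i 1 + S i i 3 \<ge> max (2 * \<bar>S i i 2\<bar>) (2 * S i i 3)) \<and>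
    (\<forall>i\<in>{1..min m n - 1}.
      (S i i 1 - S (i + 1) (i + 1) 1) + (S i i 3 - S (i + 1) (i + 1) 3)
        \<ge> max (2 * \<bar>S i i 2 - S (i + 1) (i + 1) 2\<bar>) (2 * (S i i 3 - S (i + 1) (i + 1) 3)))"
    (is "_ \<longleftrightarrow> ?a \<and> ?b \<and> ?c")
proof
  assume "S \<in> s_diagonal_tensors m n 4"
  then obtain A where A: "Kilmer_Martin m n 4 A = S"
    unfolding s_diagonal_tensors_def by blast
  note S = Kilmer_Martin_4[of _ m n A, unfolded A]
  have ?a
    by (intro ballI) (simp only: S)
  \<comment> \<open>In terms of the singular values, \<open>S1 + S3 = (d1 + d3) / 2\<close>,
    \<open>2 * S2 = (d1 - d3) / 2\<close> and \<open>S1 - S3 = d2\<close>.\<close>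
  moreover have ?b
  proof
    fix i assume i: "i \<in> {1..min m n}"
    show "S i i 1 + S i i 3 \<ge> max (2 * \<bar>S i i 2\<bar>) (2 * S i i 3)"
      unfolding S[OF i] using D_diag_nonneg[OF i, of 4 A 1] D_diag_nonneg[OF i, of 4 A 2]
        D_diag_nonneg[OF i, of 4 A 3] by (intro max.boundedI) (auto simp: abs_if field_simps)
  qed
  \<comment> \<open>The same identities, applied to differences of consecutive diagonal
    entries.\<close>
  moreover have ?c
  proof
    fix i assume i: "i \<in> {1..min m n - 1}"
    then have i': "i \<in> {1..min m n}" "i + 1 \<in> {1..min m n}" by auto
    show "(S i i 1 - S (i + 1) (i + 1) 1) + (S i i 3 - S (i + 1) (i + 1) 3)
        \<ge> max (2 * \<bar>S i i 2 - S (i + 1) (i + 1) 2\<bar>) (2 * (S i i 3 - S (i + 1) (i + 1) 3))"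
      unfolding S[OF i'(1)] S[OF i'(2)]
      using D_diag_antimono[OF i, of 4 A 1] D_diag_antimono[OF i, of 4 A 2]
        D_diag_antimono[OF i, of 4 A 3] by (intro max.boundedI) (auto simp: abs_if field_simps)
  qed
  ultimately show "?a \<and> ?b \<and> ?c" by blast
next
  assume "?a \<and> ?b \<and> ?c"
  then have a: ?a and b: ?b and c: ?c by blast+
  note off = f_diagonal_tensors_off_diagonal[OF assms(3)]
  have diag: "diagonal_mat (Delta m n 4 S k)" for k
    using off by (auto simp: diagonal_mat_def Delta_def frontal_slice_def)
  \<comment> \<open>The bound by the absolute value gives the first and third inequality, the other
    bound the second.\<close>
  have nonneg: "0 \<le> S i i 1 + 2 * S i i 2 + S i i 3" "0 \<le> S i i 1 - S i i 3"
    "0 \<le> S i i 1 - 2 * S i i 2 + S i i 3" if "i \<in> {1..min m n}" for i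
    using bspec[OF b that] unfolding max.bounded_iff by linarith+
  have antimono:
    "S (i + 1) (i + 1) 1 + 2 * S (i + 1) (i + 1) 2 + S (i + 1) (i + 1) 3
      \<le> S i i 1 + 2 * S i i 2 + S i i 3"
    "S (i + 1) (i + 1) 1 - S (i + 1) (i + 1) 3 \<le> S i i 1 - S i i 3"
    "S (i + 1) (i + 1) 1 - 2 * S (i + 1) (i + 1) 2 + S (i + 1) (i + 1) 3
      \<le> S i i 1 - 2 * S i i 2 + S i i 3" if "i \<in> {1..min m n - 1}" for i
    using bspec[OF c that] by (auto simp: abs_if split: if_splits)
  \<comment> \<open>Condition (a) cancels the imaginary part \<open>S2 - S4\<close> at 2 and turns
    \<open>S2 + S4\<close> into \<open>2 * S2\<close> at 1 and 3.\<close>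
  have Delta: "Delta m n 4 S 1 $$ (i - 1, i - 1) = of_real (S i i 1 + 2 * S i i 2 + S i i 3)"
    "Delta m n 4 S 2 $$ (i - 1, i - 1) = of_real (S i i 1 - S i i 3)"
    "Delta m n 4 S 3 $$ (i - 1, i - 1) = of_real (S i i 1 - 2 * S i i 2 + S i i 3)"
    if "i \<in> {1..min m n}" for i
    using that bspec[OF a that]
    by (cases i; simp add: Delta_def frontal_slice_def omega_4 sum_1_4 i_powers Suc_le_eq)+
  have D: "D_diag m n 4 S i 1 = S i i 1 + 2 * S i i 2 + S i i 3"
    "D_diag m n 4 S i 2 = S i i 1 - S i i 3"
    "D_diag m n 4 S i 3 = S i i 1 - 2 * S i i 2 + S i i 3"
    if "i \<in> {1..min m n}" for i
    using D_diag_diagonal[OF diag Delta(1) nonneg(1) antimono(1) that]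
      D_diag_diagonal[OF diag Delta(2) nonneg(2) antimono(2) that]
      D_diag_diagonal[OF diag Delta(3) nonneg(3) antimono(3) that] by simp_all
  have "Kilmer_Martin m n 4 S i j k = S i j k" for i j k
  proof (cases "i = j \<and> i \<in> {1..min m n} \<and> k \<in> {1..4}")
    case True
    then have "k = 1 \<or> k = 2 \<or> k = 3 \<or> k = 4" and i: "i \<in> {1..min m n}" and "j = i"
      by auto
    then show ?thesis
      using Kilmer_Martin_4[OF i, of S, unfolded D[OF i]] a by auto
  next
    case False
    \<comment> \<open>Off the diagonal this is f-diagonality; for \<open>i = j\<close> an index is
      out of range.\<close>
    then have "S i j k = 0"
      using off assms(3) by (cases "i = j") (auto simp: f_diagonal_tensors_def tensors_def)
    moreover have "Kilmer_Martin m n 4 S i j k = 0"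
      using False by (simp only: Kilmer_Martin_def if_False)
    ultimately show ?thesis by simp
  qed
  then have "Kilmer_Martin m n 4 S = S" by (intro ext)
  then show "S \<in> s_diagonal_tensors m n 4"
    using assms(3) by (auto simp: s_diagonal_tensors_def f_diagonal_tensors_def)
qed

end
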